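(* Let $K$ be a compact (pointed) metric space such that there exist a sequence $(\epsilon_n)_n$ of positive real numbers tending to $0$, a real number $\rho<1/2$, and finite $\epsilon_n$-separated subsets $N_n$ of $K$ which are $\rho\epsilon_n$-dense in $K$. Then the free space $\mathfrak{F}(K)$ has the metric approximation property.
   Context: A pointed metric space is a metric space $(M,d)$ with a distinguished point $0\in M$. $\mathrm{Lip}_0(M)$ is the Banach space of real-valued Lipschitz functions $f$ on $M$ with $f(0)=0$, with norm $\|f\|_L=\sup\{|f(x)-f(y)|/d(x,y): x\ne y\in M\}$. For $x\in M$, $\delta(x)\in \mathrm{Lip}_0(M)^*$ is the evaluation $f\mapsto f(x)$. The free space $\mathfrak{F}(M)$ is the closed linear span of $\{\delta(x): x\in M\}$ in $\mathrm{Lip}_0(M)^*$, with the induced norm. A subset $N$ of $K$ is $\epsilon$-separated if $d(x,y)\ge\epsilon$ for all distinct $x,y\in N$, and $r$-dense in $K$ if every point of $K$ is at distance at most $r$ from some point of $N$. A Banach space $X$ has the metric approximation property (MAP) if the identity $\mathrm{id}_X$ is in the closure, for the topology of uniform convergence on compact sets, of the set of finite rank bounded linear operators on $X$ of norm at most $1$. *)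

theory Defs
  imports "HOL-Analysis.Analysis"
begin

section \<open>Pointed metric spaces and the Lipschitz space\<close>

class pointed_metric_space = metric_space +
  fixes basepoint :: 'a

typedef (overloaded) ('a::pointed_metric_space) lip0 =
  "{f :: 'a \<Rightarrow> real. f basepoint = 0 \<and> (\<exists>C. C-lipschitz_on UNIV f)}"
  morphisms lip0_apply Abs_lip0
  by (rule exI[of _ "\<lambda>_. 0"]) (auto intro!: exI[of _ 0] lipschitz_onI)

setup_lifting type_definition_lip0

lemma lip0_eqI: "(\<And>x. lip0_apply f x = lip0_apply g x) \<Longrightarrow> f = g"
  by transfer auto

lemma lip0_apply_basepoint [simp]: "lip0_apply f basepoint = 0"
  by transfer simp

lemma lip0_lipschitz: "\<exists>C. C-lipschitz_on UNIV (lip0_apply f)"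
  by transfer simp

instantiation lip0 :: (pointed_metric_space) real_vector
begin

lift_definition zero_lip0 :: "'a lip0" is "\<lambda>_. 0"
  by (auto intro!: exI[of _ 0] lipschitz_onI)

lift_definition plus_lip0 :: "'a lip0 \<Rightarrow> 'a lip0 \<Rightarrow> 'a lip0" is "\<lambda>f g x. f x + g x"
  by (auto intro: lipschitz_on_add)

lift_definition uminus_lip0 :: "'a lip0 \<Rightarrow> 'a lip0" is "\<lambda>f x. - f x"
  by (auto intro: lipschitz_on_minus)

lift_definition minus_lip0 :: "'a lip0 \<Rightarrow> 'a lip0 \<Rightarrow> 'a lip0" is "\<lambda>f g x. f x - g x"
  by (auto intro: lipschitz_on_diff)

lift_definition scaleR_lip0 :: "real \<Rightarrow> 'a lip0 \<Rightarrow> 'a lip0" is "\<lambda>r f x. r * f x"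
  by (auto intro: lipschitz_on_cmult_real)

instance
  by standard (transfer; simp add: algebra_simps fun_eq_iff)+

end

lemmas lip0_apply_simps [simp] =
  zero_lip0.rep_eq plus_lip0.rep_eq uminus_lip0.rep_eq minus_lip0.rep_eq scaleR_lip0.rep_eq

lemma lip0_quotients_bdd:
  "bdd_above (range (\<lambda>(x, y). \<bar>lip0_apply f x - lip0_apply f y\<bar> / dist x y))"
proof -
  obtain C where C: "C-lipschitz_on UNIV (lip0_apply f)"
    using lip0_lipschitz by blast
  have "\<bar>lip0_apply f x - lip0_apply f y\<bar> / dist x y \<le> C" for x y
    using lipschitz_onD[OF C, of x y] lipschitz_on_nonneg[OF C]
    by (cases "x = y") (auto simp: dist_real_def divide_le_eq)
  then show ?thesis
    by (auto intro!: bdd_aboveI[of _ C])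
qed

text \<open>
  The supremum defining the norm ranges over all pairs instead of the pairs of distinct points.
  Since division by zero yields zero, a diagonal pair only contributes the value 0, so this makes
  a difference only for a one-point space, where it gives the norm 0 instead of the unspecified
  supremum of the empty set.
\<close>

instantiation lip0 :: (pointed_metric_space) real_normed_vector
begin

definition norm_lip0 :: "'a lip0 \<Rightarrow> real" where
  "norm_lip0 f = (SUP (x, y). \<bar>lip0_apply f x - lip0_apply f y\<bar> / dist x y)"

definition dist_lip0 :: "'a lip0 \<Rightarrow> 'a lip0 \<Rightarrow> real" where
  "dist_lip0 f g = norm (f - g)"

definition sgn_lip0 :: "'a lip0 \<Rightarrow> 'a lip0" where
  "sgn_lip0 f = f /\<^sub>R norm f"

definition uniformity_lip0 :: "('a lip0 \<times> 'a lip0) filter" where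
  "uniformity_lip0 = (INF e\<in>{0 <..}. principal {(f, g). dist f g < e})"

definition open_lip0 :: "'a lip0 set \<Rightarrow> bool" where
  "open_lip0 U \<longleftrightarrow> (\<forall>f\<in>U. \<forall>\<^sub>F (f', g) in uniformity. f' = f \<longrightarrow> g \<in> U)"

lemma lip0_quotient_le_norm:
  fixes f :: "'a lip0"
  shows "\<bar>lip0_apply f x - lip0_apply f y\<bar> / dist x y \<le> norm f"
  unfolding norm_lip0_def
  using cSUP_upper[OF UNIV_I lip0_quotients_bdd[of f], of "(x, y)"] by simp

lemma lip0_diff_le_norm:
  fixes f :: "'a lip0"
  shows "\<bar>lip0_apply f x - lip0_apply f y\<bar> \<le> norm f * dist x y"
  using lip0_quotient_le_norm[of f x y]
  by (cases "x = y") (auto simp: divide_le_eq)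

lemma lip0_norm_le:
  fixes f :: "'a lip0"
  assumes "0 \<le> C" "\<And>x y. \<bar>lip0_apply f x - lip0_apply f y\<bar> \<le> C * dist x y"
  shows "norm f \<le> C"
proof -
  have "\<bar>lip0_apply f x - lip0_apply f y\<bar> / dist x y \<le> C" for x y
    using assms(1) assms(2)[of x y] by (cases "x = y") (auto simp: divide_le_eq)
  then show ?thesis
    unfolding norm_lip0_def by (auto intro!: cSUP_least)
qed

instance
proof
  fix f g :: "'a lip0" and r :: real
  have nonneg: "0 \<le> norm h" for h :: "'a lip0"
    using lip0_quotient_le_norm[of h basepoint basepoint] by simp
  show "norm f = 0 \<longleftrightarrow> f = 0"
  proof
    assume "norm f = 0"
    then have "lip0_apply f x = 0" for x
      using lip0_diff_le_norm[of f x basepoint] by simp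
    then show "f = 0" by (intro lip0_eqI) simp
  next
    assume "f = 0"
    then show "norm f = 0"
      using lip0_norm_le[of 0 f] nonneg[of f] by simp
  qed
  show "norm (f + g) \<le> norm f + norm g"
  proof (rule lip0_norm_le)
    fix x y
    show "\<bar>lip0_apply (f + g) x - lip0_apply (f + g) y\<bar> \<le> (norm f + norm g) * dist x y"
      using lip0_diff_le_norm[of f x y] lip0_diff_le_norm[of g x y]
      by (simp add: algebra_simps)
  qed (use nonneg in simp)
  have le: "norm (s *\<^sub>R h) \<le> \<bar>s\<bar> * norm h" for s and h :: "'a lip0"
  proof (rule lip0_norm_le)
    fix x y
    show "\<bar>lip0_apply (s *\<^sub>R h) x - lip0_apply (s *\<^sub>R h) y\<bar> \<le> \<bar>s\<bar> * norm h * dist x y"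
      using mult_left_mono[OF lip0_diff_le_norm[of h x y], of "\<bar>s\<bar>"]
      by (simp add: abs_mult[symmetric] algebra_simps)
  qed (use nonneg in simp)
  show "norm (r *\<^sub>R f) = \<bar>r\<bar> * norm f"
  proof (cases "r = 0")
    case True
    then show ?thesis using le[of 0 f] nonneg[of "0 *\<^sub>R f"] by simp
  next
    case False
    then have "\<bar>r\<bar> * norm f \<le> norm (r *\<^sub>R f)"
      using le[of "inverse r" "r *\<^sub>R f"] by (simp add: field_simps)
    with le[of r f] show ?thesis by simp
  qed
qed (simp_all add: dist_lip0_def sgn_lip0_def uniformity_lip0_def open_lip0_def)

end

lemma lip0_apply_le_norm:
  fixes f :: "'a::pointed_metric_space lip0"
  shows "\<bar>lip0_apply f x\<bar> \<le> norm f * dist x basepoint"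
  using lip0_diff_le_norm[of f x basepoint] by simp


section \<open>The free space\<close>

lift_definition delta :: "'a::pointed_metric_space \<Rightarrow> 'a lip0 \<Rightarrow>\<^sub>L real"
  is "\<lambda>x f. lip0_apply f x"
  by (rule bounded_linear_intro) (auto intro: lip0_apply_le_norm)

typedef (overloaded) ('a::pointed_metric_space) free_space =
  "closure (span (range (delta :: 'a \<Rightarrow> 'a lip0 \<Rightarrow>\<^sub>L real)))"
  morphisms free_space_functional Abs_free_space
  by (rule exI[of _ 0], rule subsetD[OF closure_subset], rule span_zero)

setup_lifting type_definition_free_space

lemma subspace_free_space:
  "subspace (closure (span (range (delta :: 'a::pointed_metric_space \<Rightarrow> _))))"
proof -
  have "subspace (closure S)" if S: "subspace S" for S :: "('a lip0 \<Rightarrow>\<^sub>L real) set"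
  proof (rule subspaceI)
    show "0 \<in> closure S"
      using subspace_0[OF S] closure_subset by (rule subsetD[rotated])
  next
    fix x y assume "x \<in> closure S" "y \<in> closure S"
    then obtain u v where "\<And>n. u n \<in> S" "u \<longlonglongrightarrow> x" "\<And>n. v n \<in> S" "v \<longlonglongrightarrow> y"
      unfolding closure_sequential by metis
    then have "\<And>n. u n + v n \<in> S" "(\<lambda>n. u n + v n) \<longlonglongrightarrow> x + y"
      using subspace_add[OF S] tendsto_add by auto
    then show "x + y \<in> closure S"
      unfolding closure_sequential by (intro exI[of _ "\<lambda>n. u n + v n"]) simp
  next
    fix c :: real and x assume "x \<in> closure S"
    then obtain u where "\<And>n. u n \<in> S" "u \<longlonglongrightarrow> x"
      unfolding closure_sequential by metis
    then have "\<And>n. c *\<^sub>R u n \<in> S" "(\<lambda>n. c *\<^sub>R u n) \<longlonglongrightarrow> c *\<^sub>R x"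
      using subspace_scale[OF S] tendsto_scaleR[OF tendsto_const] by auto
    then show "c *\<^sub>R x \<in> closure S"
      unfolding closure_sequential by (intro exI[of _ "\<lambda>n. c *\<^sub>R u n"]) simp
  qed
  then show ?thesis by (simp add: subspace_span)
qed

instantiation free_space :: (pointed_metric_space) real_vector
begin

lift_definition zero_free_space :: "'a free_space" is 0
  by (rule subspace_0[OF subspace_free_space])

lift_definition plus_free_space :: "'a free_space \<Rightarrow> 'a free_space \<Rightarrow> 'a free_space" is "(+)"
  by (rule subspace_add[OF subspace_free_space])

lift_definition uminus_free_space :: "'a free_space \<Rightarrow> 'a free_space" is uminus
  by (rule subspace_neg[OF subspace_free_space])

lift_definition minus_free_space :: "'a free_space \<Rightarrow> 'a free_space \<Rightarrow> 'a free_space" is "(-)"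
  by (rule subspace_diff[OF subspace_free_space])

lift_definition scaleR_free_space :: "real \<Rightarrow> 'a free_space \<Rightarrow> 'a free_space" is "scaleR"
  by (rule subspace_scale[OF subspace_free_space])

instance
  by standard (transfer; simp add: algebra_simps)+

end

instantiation free_space :: (pointed_metric_space) real_normed_vector
begin

lift_definition norm_free_space :: "'a free_space \<Rightarrow> real" is norm .

definition dist_free_space :: "'a free_space \<Rightarrow> 'a free_space \<Rightarrow> real" where
  "dist_free_space u v = norm (u - v)"

definition sgn_free_space :: "'a free_space \<Rightarrow> 'a free_space" where
  "sgn_free_space u = u /\<^sub>R norm u"

definition uniformity_free_space :: "('a free_space \<times> 'a free_space) filter" where
  "uniformity_free_space = (INF e\<in>{0 <..}. principal {(u, v). dist u v < e})"

definition open_free_space :: "'a free_space set \<Rightarrow> bool" where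
  "open_free_space U \<longleftrightarrow> (\<forall>u\<in>U. \<forall>\<^sub>F (u', v) in uniformity. u' = u \<longrightarrow> v \<in> U)"

instance
proof
  fix u v :: "'a free_space" and r :: real
  show "norm u = 0 \<longleftrightarrow> u = 0" by transfer simp
  show "norm (u + v) \<le> norm u + norm v" by transfer (rule norm_triangle_ineq)
  show "norm (r *\<^sub>R u) = \<bar>r\<bar> * norm u" by transfer simp
qed (simp_all add: dist_free_space_def sgn_free_space_def uniformity_free_space_def
      open_free_space_def)

end

lemma dist_free_space: "dist u v = dist (free_space_functional u) (free_space_functional v)"
  unfolding dist_free_space_def dist_norm by transfer simp

instance free_space :: (pointed_metric_space) banach
proof
  fix X :: "nat \<Rightarrow> 'a free_space"
  assume "Cauchy X"
  then have "Cauchy (\<lambda>n. free_space_functional (X n))"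
    by (simp add: Cauchy_def dist_free_space)
  then obtain l where l: "(\<lambda>n. free_space_functional (X n)) \<longlonglongrightarrow> l"
    using Cauchy_convergent convergent_def by blast
  then have "l \<in> closure (span (range delta))"
    by (rule closed_sequentially[OF closed_closure free_space_functional])
  then have "X \<longlonglongrightarrow> Abs_free_space l"
    using l by (simp add: tendsto_iff dist_free_space Abs_free_space_inverse)
  then show "convergent X"
    by (rule convergentI)
qed


section \<open>The metric approximation property\<close>

text \<open>
  Uniform convergence on compact sets makes sense for arbitrary functions, so the topology lives on
  the whole function type. The identity is itself a bounded operator, so whether it lies in the
  closure of a set of bounded operators is the same here as in the subspace of bounded operators.
\<close>

definition compact_convergence_open ::
    "('a::topological_space \<Rightarrow> 'b::metric_space) set \<Rightarrow> bool" where
  "compact_convergence_open U \<longleftrightarrow>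
    (\<forall>f\<in>U. \<exists>C e. compact C \<and> e > 0 \<and> {g. \<forall>x\<in>C. dist (g x) (f x) < e} \<subseteq> U)"

lemma compact_convergence_openE:
  assumes "compact_convergence_open U" "f \<in> U"
  obtains C e where "compact C" "e > 0" "{g. \<forall>x\<in>C. dist (g x) (f x) < e} \<subseteq> U"
  using bspec[OF assms(1)[unfolded compact_convergence_open_def] assms(2)]
  by (elim exE conjE) (rule that)

lemma istopology_compact_convergence_open: "istopology compact_convergence_open"
  unfolding istopology_def
proof (intro conjI allI impI)
  fix S T :: "('a \<Rightarrow> 'b) set"
  assume S: "compact_convergence_open S" and T: "compact_convergence_open T"
  show "compact_convergence_open (S \<inter> T)"
    unfolding compact_convergence_open_def
  proof
    fix f assume f: "f \<in> S \<inter> T"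
    obtain C d where C: "compact C" "d > 0" "{g. \<forall>x\<in>C. dist (g x) (f x) < d} \<subseteq> S"
      using S IntD1[OF f] by (rule compact_convergence_openE)
    obtain D e where D: "compact D" "e > 0" "{g. \<forall>x\<in>D. dist (g x) (f x) < e} \<subseteq> T"
      using T IntD2[OF f] by (rule compact_convergence_openE)
    have "{g. \<forall>x\<in>C \<union> D. dist (g x) (f x) < min d e} \<subseteq> S \<inter> T"
      using C(3) D(3) by auto
    moreover have "compact (C \<union> D)" "min d e > 0"
      using C D by auto
    ultimately show "\<exists>C e. compact C \<and> e > 0 \<and> {g. \<forall>x\<in>C. dist (g x) (f x) < e} \<subseteq> S \<inter> T"
      by (intro exI[of _ "C \<union> D"] exI[of _ "min d e"]) simp
  qed
next
  fix \<K> :: "('a \<Rightarrow> 'b) set set"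
  assume *: "\<forall>S\<in>\<K>. compact_convergence_open S"
  show "compact_convergence_open (\<Union>\<K>)"
    unfolding compact_convergence_open_def
  proof
    fix f assume "f \<in> \<Union>\<K>"
    then obtain S where "S \<in> \<K>" "f \<in> S" by (rule UnionE)
    obtain C e where "compact C" "e > 0" "{g. \<forall>x\<in>C. dist (g x) (f x) < e} \<subseteq> S"
      using bspec[OF * \<open>S \<in> \<K>\<close>] \<open>f \<in> S\<close> by (rule compact_convergence_openE)
    moreover have "S \<subseteq> \<Union>\<K>"
      using \<open>S \<in> \<K>\<close> by blast
    ultimately show "\<exists>C e. compact C \<and> e > 0 \<and> {g. \<forall>x\<in>C. dist (g x) (f x) < e} \<subseteq> \<Union>\<K>"
      by (meson subset_trans)
  qed
qed

definition compact_convergence :: "('a::topological_space \<Rightarrow> 'b::metric_space) topology" where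
  "compact_convergence = topology compact_convergence_open"

lemma openin_compact_convergence:
  "openin compact_convergence U \<longleftrightarrow> compact_convergence_open U"
  by (simp add: compact_convergence_def istopology_compact_convergence_open)

lemma topspace_compact_convergence [simp]: "topspace compact_convergence = UNIV"
proof -
  have "compact_convergence_open UNIV"
    unfolding compact_convergence_open_def by (auto intro!: exI[of _ "{}"] exI[of _ "1::real"])
  then show ?thesis
    by (metis openin_compact_convergence openin_subset top.extremum_uniqueI)
qed

lemma compact_convergence_closure_iff:
  "f \<in> compact_convergence closure_of A \<longleftrightarrow>
    (\<forall>C e. compact C \<longrightarrow> e > 0 \<longrightarrow> (\<exists>g\<in>A. \<forall>x\<in>C. dist (g x) (f x) < e))"
proof
  assume L: "f \<in> compact_convergence closure_of A"
  show "\<forall>C e. compact C \<longrightarrow> e > 0 \<longrightarrow> (\<exists>g\<in>A. \<forall>x\<in>C. dist (g x) (f x) < e)"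
  proof (intro allI impI)
    fix C :: "'a set" and e :: real
    assume C: "compact C" and e: "e > 0"
    define U where "U = {g. \<exists>d<e. \<forall>x\<in>C. dist (g x) (f x) \<le> d}"
    have "compact_convergence_open U"
      unfolding compact_convergence_open_def
    proof
      fix g assume "g \<in> U"
      then obtain d where d: "d < e" "\<And>x. x \<in> C \<Longrightarrow> dist (g x) (f x) \<le> d"
        unfolding U_def by blast
      have "h \<in> U" if h: "\<forall>x\<in>C. dist (h x) (g x) < (e - d) / 2" for h
      proof -
        have "dist (h x) (f x) \<le> (e + d) / 2" if "x \<in> C" for x
        proof -
          have "dist (h x) (f x) \<le> dist (h x) (g x) + dist (g x) (f x)"
            by (rule dist_triangle)
          moreover have "dist (h x) (g x) < (e - d) / 2" using h that by blast
          ultimately show ?thesis using d(2)[OF that] by (simp add: field_simps)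
        qed
        moreover have "(e + d) / 2 < e" using d by simp
        ultimately show ?thesis unfolding U_def by blast
      qed
      moreover have "(e - d) / 2 > 0" using d by simp
      ultimately show "\<exists>C e. compact C \<and> e > 0 \<and> {h. \<forall>x\<in>C. dist (h x) (g x) < e} \<subseteq> U"
        using C by blast
    qed
    moreover have "f \<in> U" unfolding U_def using e by auto
    ultimately obtain g where g: "g \<in> A" "g \<in> U"
      using L unfolding in_closure_of openin_compact_convergence by blast
    then obtain d where "d < e" "\<forall>x\<in>C. dist (g x) (f x) \<le> d"
      unfolding U_def by blast
    then have "\<forall>x\<in>C. dist (g x) (f x) < e"
      by (meson le_less_trans)
    with g show "\<exists>g\<in>A. \<forall>x\<in>C. dist (g x) (f x) < e"
      by blast
  qed
next
  assume R: "\<forall>C e. compact C \<longrightarrow> e > 0 \<longrightarrow> (\<exists>g\<in>A. \<forall>x\<in>C. dist (g x) (f x) < e)"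
  show "f \<in> compact_convergence closure_of A"
    unfolding in_closure_of openin_compact_convergence
  proof (intro conjI allI impI)
    fix U assume U: "f \<in> U \<and> compact_convergence_open U"
    obtain C e where C: "compact C" "e > 0" "{g. \<forall>x\<in>C. dist (g x) (f x) < e} \<subseteq> U"
      using conjunct2[OF U] conjunct1[OF U] by (rule compact_convergence_openE)
    obtain g where "g \<in> A" "\<forall>x\<in>C. dist (g x) (f x) < e"
      using R C(1,2) by meson
    with C(3) show "\<exists>g. g \<in> A \<and> g \<in> U"
      by (intro exI[of _ g]) auto
  qed simp
qed

definition finite_rank :: "('a::real_normed_vector \<Rightarrow>\<^sub>L 'b::real_normed_vector) \<Rightarrow> bool" where
  "finite_rank T \<longleftrightarrow> (\<exists>B. finite B \<and> range (blinfun_apply T) \<subseteq> span B)"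

definition metric_approximation_property :: "'b::banach itself \<Rightarrow> bool" where
  "metric_approximation_property _ \<longleftrightarrow>
    (id :: 'b \<Rightarrow> 'b) \<in> compact_convergence closure_of
      {blinfun_apply T |T :: 'b \<Rightarrow>\<^sub>L 'b. finite_rank T \<and> norm T \<le> 1}"


section \<open>Separated and dense subsets\<close>

definition separated_set :: "real \<Rightarrow> 'a::metric_space set \<Rightarrow> bool" where
  "separated_set e N \<longleftrightarrow> (\<forall>x\<in>N. \<forall>y\<in>N. x \<noteq> y \<longrightarrow> e \<le> dist x y)"

definition dense_within :: "real \<Rightarrow> 'a::metric_space set \<Rightarrow> 'a set \<Rightarrow> bool" where
  "dense_within r N K \<longleftrightarrow> N \<subseteq> K \<and> (\<forall>x\<in>K. \<exists>y\<in>N. dist x y \<le> r)"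

end

(*
  Since rho < 1/2, every point has a unique nearest point in N_n up to rho * eps_n, and this gives
  a retraction r_n onto N_n that is constant on balls of radius s * eps_n, s = 1 - 2 * rho.
  Composition f |-> f o r_n has norm at most about 1/s > 1 on Lip_0, but a pair of points at
  distance t witnesses a constant noticeably above 1 only when s * eps_n <= t and eps_n is not
  much smaller than t. Averaging f o r_n over k scales that decrease fast enough, each pair meets
  at most one bad scale, so the average has norm at most 1 + O(1/k). After normalisation, these
  operators are adjoints of finite rank contractions of the free space that converge to the
  identity on every delta(x), hence uniformly on compact sets.
*)
theory Submission
  imports Defs
begin

section \<open>Pointwise convergence of contractions and convergence on compact sets\<close>

text \<open>Maps of norm at most 1 are equicontinuous. Pointwise convergence is therefore uniform on
  the finitely many centres of an \<open>e / 3\<close>-cover of \<open>C\<close>, and a three-term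
  triangle estimate carries it to all of \<open>C\<close>.\<close>

lemma compact_convergence_closureI:
  fixes T :: "nat \<Rightarrow> 'b::real_normed_vector \<Rightarrow>\<^sub>L 'b"
  assumes "\<And>n. T n \<in> \<A>" and norm: "\<And>n. norm (T n) \<le> 1"
    and lim: "\<And>u. (\<lambda>n. T n u) \<longlonglongrightarrow> u"
  shows "id \<in> compact_convergence closure_of (blinfun_apply ` \<A>)"
  unfolding compact_convergence_closure_iff
proof (intro allI impI)
  fix C :: "'b set" and e :: real
  assume C: "compact C" and e: "e > 0"
  obtain F where F: "finite F" "C \<subseteq> (\<Union>u\<in>F. ball u (e / 3))"
    using compactE_image[OF C, of C "\<lambda>u. ball u (e / 3)"] e
    by (metis (no_types, lifting) UN_I centre_in_ball divide_pos_pos open_ball subsetI zero_less_numeral)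
  have "\<forall>\<^sub>F n in sequentially. \<forall>u\<in>F. dist (T n u) u < e / 3"
    using e by (intro eventually_ball_finite[OF F(1)] ballI tendstoD[OF lim]) simp
  then obtain n where n: "\<And>u. u \<in> F \<Longrightarrow> dist (T n u) u < e / 3"
    by (auto simp: eventually_sequentially)
  have "dist (T n v) (id v) < e" if "v \<in> C" for v
  proof -
    obtain u where u: "u \<in> F" "dist u v < e / 3"
      using F(2) \<open>v \<in> C\<close> by auto
    have "dist (T n v) (T n u) \<le> norm (T n) * dist v u"
      by (metis blinfun.diff_right dist_norm norm_blinfun)
    also have "\<dots> \<le> dist v u"
      using mult_right_mono[OF norm[of n], of "dist v u"] by simp
    finally have "dist (T n v) (T n u) < e / 3"
      using u(2) by (simp add: dist_commute)
    then show ?thesis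
      using n[OF u(1)] u(2) dist_triangle[of "T n v" v u] dist_triangle[of "T n v" u "T n u"]
      by simp
  qed
  then show "\<exists>g\<in>blinfun_apply ` \<A>. \<forall>x\<in>C. dist (g x) (id x) < e"
    using assms(1) by blast
qed

section \<open>Preadjoint operators on the free space and density of the evaluations\<close>

lemma linear_free_space_functional: "linear free_space_functional"
  by (rule linearI; transfer) auto

lemma inj_free_space_functional: "inj free_space_functional"
  by (meson free_space_functional_inject injI)

lemma delta_in_free_space: "delta x \<in> closure (span (range delta))"
  by (meson closure_subset rangeI span_base subsetD)

text \<open>Precomposition with \<open>A\<close> is the adjoint of \<open>A\<close> on the dual of
  the Lipschitz space. The span hypothesis forces its values into finitely many evaluations, so it
  restricts to the free space with finite rank. This restriction is \<open>T\<close>, and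
  \<open>A\<close> plays the role of its adjoint.\<close>

lemma free_space_predual:
  fixes A :: "'a::pointed_metric_space lip0 \<Rightarrow>\<^sub>L 'a lip0"
  assumes "finite B" and span: "\<And>\<phi>. \<phi> o\<^sub>L A \<in> span (delta ` B)"
  obtains T :: "'a free_space \<Rightarrow>\<^sub>L 'a free_space"
  where "\<And>u. free_space_functional (T u) = free_space_functional u o\<^sub>L A"
    and "finite_rank T" and "norm T \<le> norm A"
proof -
  define t where "t u = Abs_free_space (free_space_functional u o\<^sub>L A)" for u
  have t: "free_space_functional (t u) = free_space_functional u o\<^sub>L A" for u
  proof -
    have "free_space_functional u o\<^sub>L A \<in> closure (span (range delta))"
      using span[of "free_space_functional u"] span_mono[of "delta ` B" "range delta"]
      by (meson closure_subset image_mono subsetD subset_UNIV)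
    then show ?thesis
      by (simp add: t_def Abs_free_space_inverse)
  qed
  have norm_t: "norm (t u) \<le> norm u * norm A" for u
    using norm_blinfun_compose[of "free_space_functional u" A]
    by (simp add: norm_free_space.rep_eq t)
  have "bounded_linear t"
  proof (rule bounded_linear_intro)
    show "t (u + v) = t u + t v" for u v
      by (simp add: free_space_functional_inject[symmetric] t plus_free_space.rep_eq
          blinfun_eqI blinfun.add_left)
    show "t (c *\<^sub>R u) = c *\<^sub>R t u" for c u
      by (simp add: free_space_functional_inject[symmetric] t scaleR_free_space.rep_eq
          blinfun_eqI blinfun.scaleR_left)
  qed (rule norm_t)
  then have T: "blinfun_apply (Blinfun t) = t"
    by (rule bounded_linear_Blinfun_apply)
  have "finite_rank (Blinfun t)"
    unfolding finite_rank_def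
  proof (intro exI conjI)
    let ?S = "(Abs_free_space \<circ> delta) ` B"
    show "finite ?S"
      using \<open>finite B\<close> by simp
    \<comment> \<open>The finite span is given among functionals; linearity and injectivity of the
      embedding \<open>free_space_functional\<close> pull it back to the free space.\<close>
    have "free_space_functional ` ?S = delta ` B"
      by (simp add: image_image Abs_free_space_inverse[OF delta_in_free_space])
    then have "free_space_functional (t u) \<in> free_space_functional ` span ?S" for u
      by (metis linear_span_image[OF linear_free_space_functional] span t)
    then show "range (blinfun_apply (Blinfun t)) \<subseteq> span ?S"
      by (auto simp: T inj_image_mem_iff[OF inj_free_space_functional])
  qed
  moreover have "norm (Blinfun t) \<le> norm A"
    by (rule norm_blinfun_bound) (use norm_t in \<open>simp_all add: T mult.commute\<close>)
  ultimately show ?thesis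
    using that[of "Blinfun t"] t by (simp add: T)
qed

text \<open>Convergence at the evaluations passes to their linear span, which is dense; the uniform
  norm bound then extends it to every \<open>u\<close>.\<close>

lemma free_space_tendstoI:
  fixes T :: "nat \<Rightarrow> 'a::pointed_metric_space free_space \<Rightarrow>\<^sub>L 'a free_space"
  assumes norm: "\<And>n. norm (T n) \<le> 1"
    and lim: "\<And>x. (\<lambda>n. free_space_functional (T n (Abs_free_space (delta x)))) \<longlonglongrightarrow> delta x"
  shows "(\<lambda>n. T n u) \<longlonglongrightarrow> u"
proof -
  define D :: "'a free_space set" where "D = range (Abs_free_space \<circ> delta)"
  have lim_span: "(\<lambda>n. T n v) \<longlonglongrightarrow> v" if "v \<in> span D" for v
    using that
  proof (induction rule: span_induct_alt)
    case base
    then show ?case by (simp add: blinfun.zero_right)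
  next
    case (step c v w)
    then obtain x where v: "v = Abs_free_space (delta x)"
      by (auto simp: D_def)
    have "(\<lambda>n. T n v) \<longlonglongrightarrow> v"
      using lim[of x] by (simp add: v tendsto_iff dist_free_space
          Abs_free_space_inverse[OF delta_in_free_space])
    then show ?case
      using step by (auto simp: blinfun.add_right blinfun.scaleR_right intro!: tendsto_intros)
  qed
  \<comment> \<open>The free space embeds isometrically as the closure of the span of the
    evaluations, so approximants found among functionals come from \<open>span D\<close>.\<close>
  have dense: "\<exists>v\<in>span D. dist u v < e" if "e > 0" for e
  proof -
    have "free_space_functional ` D = range delta"
      by (simp add: D_def image_image Abs_free_space_inverse[OF delta_in_free_space])
    then have "free_space_functional ` span D = span (range delta)"
      by (metis linear_span_image[OF linear_free_space_functional])
    moreover obtain \<phi> where "\<phi> \<in> span (range delta)" "dist \<phi> (free_space_functional u) < e"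
      using free_space_functional[of u] \<open>e > 0\<close> by (meson closure_approachable)
    ultimately obtain v where "v \<in> span D" "dist (free_space_functional v) (free_space_functional u) < e"
      by (metis imageE)
    then show ?thesis
      by (auto simp: dist_free_space dist_commute)
  qed
  show ?thesis
  proof (rule tendstoI)
    fix e :: real assume e: "e > 0"
    obtain v where v: "v \<in> span D" "dist u v < e / 3"
      using dense[of "e / 3"] e by auto
    have "\<forall>\<^sub>F n in sequentially. dist (T n v) v < e / 3"
      using tendstoD[OF lim_span[OF v(1)], of "e / 3"] e by simp
    then show "\<forall>\<^sub>F n in sequentially. dist (T n u) u < e"
    proof eventually_elim
      case (elim n)
      have "dist (T n u) (T n v) \<le> norm (T n) * dist u v"
        by (metis blinfun.diff_right dist_norm norm_blinfun)
      also have "\<dots> \<le> dist u v"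
        using mult_right_mono[OF norm[of n], of "dist u v"] by simp
      finally show ?case
        using elim v(2) dist_triangle[of "T n u" u v] dist_commute[of u v] dist_triangle[of "T n u" v "T n v"]
        by simp
    qed
  qed
qed

section \<open>Sampling operators on Lipschitz functions and their averages over scales\<close>

text \<open>Since \<open>r\<close> has finitely many values, composition with \<open>r\<close> is a
  finite sum of the values \<open>f z\<close> times indicators of the fibres of \<open>r\<close>.
  Local constancy keeps distinct fibres at distance at least \<open>s\<close>, which makes these
  indicators Lipschitz. The value at \<open>r basepoint\<close> is subtracted because
  \<open>r\<close> may move the base point.\<close>

lemma locally_constant_sampling:
  fixes r :: "'a::pointed_metric_space \<Rightarrow> 'a"
  assumes "finite (range r)" "s > 0" and const: "\<And>x y. dist x y < s \<Longrightarrow> r x = r y"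
  obtains P :: "'a lip0 \<Rightarrow>\<^sub>L 'a lip0"
  where "\<And>f x. lip0_apply (P f) x = lip0_apply f (r x) - lip0_apply f (r basepoint)"
    and "\<And>\<phi>. \<phi> o\<^sub>L P \<in> span (delta ` range r)"
proof -
  \<comment> \<open>The indicator of the fibre over \<open>z\<close>, shifted by a constant so as to
    vanish at the base point.\<close>
  define ind where "ind z x = (of_bool (r x = z) - of_bool (r basepoint = z) :: real)" for z x
  have "(1 / s)-lipschitz_on UNIV (ind z)" for z
  proof (rule lipschitz_onI)
    show "dist (ind z x) (ind z y) \<le> 1 / s * dist x y" for x y
    proof (cases "dist x y < s")
      case True
      then show ?thesis
        using const[OF True] \<open>s > 0\<close> by (simp add: ind_def)
    next
      case False
      then show ?thesis
        using \<open>s > 0\<close> by (auto simp: ind_def dist_real_def field_simps)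
    qed
  qed (use \<open>s > 0\<close> in simp)
  then have ind: "lip0_apply (Abs_lip0 (ind z)) = ind z" for z
    by (intro Abs_lip0_inverse CollectI conjI exI) (simp add: ind_def)
  \<comment> \<open>A sum of rank-one operators: boundedness is automatic, and composing any
    functional with it visibly gives a combination of the \<open>delta z\<close>.\<close>
  define P where "P = (\<Sum>z\<in>range r. blinfun_scaleR_left (Abs_lip0 (ind z)) o\<^sub>L delta z)"
  have P: "P f = (\<Sum>z\<in>range r. lip0_apply f z *\<^sub>R Abs_lip0 (ind z))" for f
    by (simp add: P_def blinfun.sum_left delta.rep_eq)
  have sum_apply: "lip0_apply (\<Sum>z\<in>Z. g z) x = (\<Sum>z\<in>Z. lip0_apply (g z) x)"
    for Z :: "'a set" and g :: "'a \<Rightarrow> 'a lip0" and x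
    by (induction Z rule: infinite_finite_induct) simp_all
  show ?thesis
  proof (rule that[of P])
    show "lip0_apply (P f) x = lip0_apply f (r x) - lip0_apply f (r basepoint)" for f x
      using \<open>finite (range r)\<close>
      by (simp add: P sum_apply ind ind_def right_diff_distrib sum_subtractf of_bool_def
          if_distrib[of "\<lambda>c. _ * c"] sum.delta' cong: if_cong)
    have "\<phi> o\<^sub>L P = (\<Sum>z\<in>range r. \<phi> (Abs_lip0 (ind z)) *\<^sub>R delta z)" for \<phi>
      by (rule blinfun_eqI)
        (simp add: P blinfun.sum_left blinfun.sum_right blinfun.scaleR_left blinfun.scaleR_right
          delta.rep_eq mult.commute)
    then show "\<phi> o\<^sub>L P \<in> span (delta ` range r)" for \<phi>
      by (simp add: span_sum span_scale span_base)
  qed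
qed

text \<open>The constant \<open>c\<close> bounds the norm of the plain average: every scale
  contributes at most \<open>1 + 1 / k\<close>, and the single possible bad scale adds
  \<open>1 / s\<close> to the sum, hence \<open>1 / (s * k)\<close> to the average. Dividing by
  \<open>c\<close> yields a contraction; the price is the term
  \<open>(1 - 1 / c) * dist x basepoint\<close> in the error.\<close>

lemma averaged_samplings:
  fixes r :: "nat \<Rightarrow> 'a::pointed_metric_space \<Rightarrow> 'a" and e :: "nat \<Rightarrow> real" and k :: nat and c :: real
  assumes s: "0 < s" and k: "0 < k"
    and fin: "\<And>j. finite (range (r j))" and pos: "\<And>j. 0 < e j"
    and const: "\<And>j x y. dist x y < s * e j \<Longrightarrow> r j x = r j y"
    and near: "\<And>j x. dist x (r j x) \<le> e j / 2"
    and decay: "\<And>i j. i < j \<Longrightarrow> e j \<le> s / real k * e i"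
    and small: "\<And>j. e j \<le> 1 / real k"
    and c: "c = 1 + 1 / real k + 1 / (s * real k)"
  obtains T :: "'a free_space \<Rightarrow>\<^sub>L 'a free_space"
  where "finite_rank T" and "norm T \<le> 1"
    and "\<And>x. norm (free_space_functional (T (Abs_free_space (delta x))) - delta x)
      \<le> 1 / real k + (1 - 1 / c) * dist x basepoint"
proof -
  have c1: "1 \<le> c"
    using s by (simp add: c)
  have "\<exists>P :: 'a lip0 \<Rightarrow>\<^sub>L 'a lip0.
      (\<forall>f x. lip0_apply (blinfun_apply P f) x = lip0_apply f (r j x) - lip0_apply f (r j basepoint)) \<and>
      (\<forall>\<phi>. \<phi> o\<^sub>L P \<in> span (delta ` range (r j)))" for j
    using s pos[of j] by (metis locally_constant_sampling[OF fin _ const] mult_pos_pos)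
  then obtain P :: "nat \<Rightarrow> 'a lip0 \<Rightarrow>\<^sub>L 'a lip0" where
    P: "\<And>j f x. lip0_apply (P j f) x = lip0_apply f (r j x) - lip0_apply f (r j basepoint)"
    and P_span: "\<And>j \<phi>. \<phi> o\<^sub>L P j \<in> span (delta ` range (r j))"
    by metis
  define A where "A = (1 / (c * real k)) *\<^sub>R (\<Sum>j<k. P j)"
  have sum_apply: "lip0_apply (\<Sum>j<n. g j) x = (\<Sum>j<n. lip0_apply (g j) x)"
    for n :: nat and g :: "nat \<Rightarrow> 'a lip0" and x
    by (induction n) simp_all
  have A: "lip0_apply (A f) x = 1 / (c * real k) * (\<Sum>j<k. lip0_apply (P j f) x)" for f x
    by (simp add: A_def blinfun.scaleR_left blinfun.sum_left sum_apply)
  have A_span: "\<phi> o\<^sub>L A \<in> span (delta ` (\<Union>j<k. range (r j)))" for \<phi>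
  proof -
    have "\<phi> o\<^sub>L A = (1 / (c * real k)) *\<^sub>R (\<Sum>j<k. \<phi> o\<^sub>L P j)"
      by (rule blinfun_eqI) (simp add: A_def blinfun.bilinear_simps blinfun.sum_left blinfun.sum_right)
    moreover have "\<phi> o\<^sub>L P j \<in> span (delta ` (\<Union>j<k. range (r j)))" if "j < k" for j
      using P_span[of \<phi> j] span_mono[of "delta ` range (r j)" "delta ` (\<Union>j<k. range (r j))"] that
      by blast
    ultimately show ?thesis
      by (auto intro!: span_scale span_sum)
  qed
  have norm_A: "norm (A f) \<le> norm f" for f
  proof (rule lip0_norm_le)
    fix x y :: 'a
    define t where "t = dist x y"
    define L where "L = norm f"
    have "0 \<le> L" "0 \<le> t"
      by (simp_all add: L_def t_def)
    \<comment> \<open>the bad scales for the pair \<open>x\<close>, \<open>y\<close>\<close>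
    define J where "J = {j. j < k \<and> s * e j \<le> t \<and> t / real k < e j}"
    have "J \<subseteq> {..<k}"
      by (auto simp: J_def)
    \<comment> \<open>If \<open>i\<close> is bad, the decay gives
      \<open>e j \<le> s * e i / k \<le> t / k\<close>, so the smaller scale \<open>j\<close> is
      already good.\<close>
    have not_both: "\<not> (i \<in> J \<and> j \<in> J)" if "i < j" for i j
    proof
      assume "i \<in> J \<and> j \<in> J"
      then have "s * e i \<le> t" "t / real k < e j"
        by (simp_all add: J_def)
      moreover have "s * e i / real k \<le> t / real k"
        using \<open>s * e i \<le> t\<close> by (intro divide_right_mono) simp_all
      ultimately show False
        using decay[OF that] by simp
    qed
    have "\<forall>i\<in>J. \<forall>j\<in>J. i = j"
      using not_both by (metis linorder_neqE_nat)
    then have card: "card J \<le> 1"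
      using card_le_Suc0_iff_eq[OF finite_subset[OF \<open>J \<subseteq> {..<k}\<close>]] by simp
    \<comment> \<open>For \<open>t < s * e j\<close> both points have the same sample and the
      difference vanishes. Otherwise sampling lengthens the distance by at most \<open>e j\<close>,
      which is at most \<open>t / k\<close> at a good scale and at most \<open>t / s\<close> at a
      bad one.\<close>
    have "\<bar>lip0_apply (P j f) x - lip0_apply (P j f) y\<bar>
        \<le> L * (t + t / real k) + (if j \<in> J then L * (t / s) else 0)" if "j < k" for j
    proof (cases "t < s * e j")
      case True
      then show ?thesis
        using const[of x y j] \<open>0 \<le> L\<close> \<open>0 \<le> t\<close> s by (simp add: P t_def)
    next
      case False
      have "dist (r j x) (r j y) \<le> t + e j"
        using near[of x j] near[of y j] dist_triangle[of "r j x" "r j y" x]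
          dist_triangle[of x "r j y" y]
        by (simp add: t_def dist_commute)
      also have "\<dots> \<le> t + t / real k + (if j \<in> J then t / s else 0)"
      proof (cases "j \<in> J")
        case True
        have "e j \<le> t / s"
          using \<open>\<not> t < s * e j\<close> s by (simp add: field_simps)
        moreover have "0 \<le> t / real k"
          using \<open>0 \<le> t\<close> by simp
        ultimately show ?thesis
          unfolding if_P[OF True] by linarith
      next
        case False
        then have "e j \<le> t / real k"
          using \<open>\<not> t < s * e j\<close> that unfolding J_def mem_Collect_eq by linarith
        then show ?thesis
          unfolding if_not_P[OF False] by linarith
      qed
      finally have "L * dist (r j x) (r j y) \<le> L * (t + t / real k + (if j \<in> J then t / s else 0))"
        using \<open>0 \<le> L\<close> by (rule mult_left_mono)
      then show ?thesis
        using lip0_diff_le_norm[of f "r j x" "r j y"]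
        unfolding P L_def[symmetric]
        by (cases "j \<in> J") (simp_all only: if_True if_False distrib_left mult_zero_right)
    qed
    then have "(\<Sum>j<k. \<bar>lip0_apply (P j f) x - lip0_apply (P j f) y\<bar>)
        \<le> (\<Sum>j<k. L * (t + t / real k) + (if j \<in> J then L * (t / s) else 0))"
      by (intro sum_mono) simp
    also have "\<dots> = real k * (L * (t + t / real k)) + real (card J) * (L * (t / s))"
      using \<open>J \<subseteq> {..<k}\<close> by (simp add: sum.distrib sum.If_cases inf.absorb2)
    also have "\<dots> \<le> real k * (L * (t + t / real k)) + 1 * (L * (t / s))"
      using card \<open>0 \<le> L\<close> \<open>0 \<le> t\<close> s by (intro add_left_mono mult_right_mono) simp_all
    \<comment> \<open>This identity dictates the value of \<open>c\<close>:
      \<open>c * k = k + 1 + 1 / s\<close>.\<close>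
    also have "\<dots> = c * real k * (L * t)"
      using s k by (simp add: c field_simps)
    finally have "\<bar>\<Sum>j<k. lip0_apply (P j f) x - lip0_apply (P j f) y\<bar> \<le> c * real k * (L * t)"
      by (rule order_trans[OF sum_abs])
    then have "1 / (c * real k) * \<bar>\<Sum>j<k. lip0_apply (P j f) x - lip0_apply (P j f) y\<bar> \<le> L * t"
      using c1 k by (simp add: field_simps)
    moreover have "lip0_apply (A f) x - lip0_apply (A f) y
        = 1 / (c * real k) * (\<Sum>j<k. lip0_apply (P j f) x - lip0_apply (P j f) y)"
      by (simp add: A sum_subtractf diff_divide_distrib)
    ultimately show "\<bar>lip0_apply (A f) x - lip0_apply (A f) y\<bar> \<le> norm f * dist x y"
      using c1 by (simp add: abs_mult L_def t_def)
  qed simp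
  have "norm A \<le> 1"
    by (rule norm_blinfun_bound) (simp_all add: norm_A)
  have close: "\<bar>lip0_apply (A f) x - lip0_apply f x\<bar>
      \<le> (1 / real k + (1 - 1 / c) * dist x basepoint) * norm f" for f x
  proof -
    \<comment> \<open>Moving \<open>x\<close> and moving the base point cost \<open>e j / 2\<close>
      each.\<close>
    have "\<bar>lip0_apply (P j f) x - lip0_apply f x\<bar> \<le> norm f * (1 / real k)" for j
    proof -
      have "\<bar>lip0_apply (P j f) x - lip0_apply f x\<bar>
          \<le> norm f * dist (r j x) x + norm f * dist (r j basepoint) basepoint"
        using lip0_diff_le_norm[of f "r j x" x] lip0_diff_le_norm[of f "r j basepoint" basepoint]
        by (simp add: P)
      also have "\<dots> = norm f * (dist x (r j x) + dist basepoint (r j basepoint))"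
        by (simp add: distrib_left dist_commute)
      also have "\<dots> \<le> norm f * (1 / real k)"
        using near[of x j] near[of basepoint j] small[of j] by (intro mult_left_mono) simp_all
      finally show ?thesis .
    qed
    then have "\<bar>\<Sum>j<k. lip0_apply (P j f) x - lip0_apply f x\<bar> \<le> real k * (norm f * (1 / real k))"
      using sum_norm_bound[of "{..<k}" "\<lambda>j. lip0_apply (P j f) x - lip0_apply f x"
          "norm f * (1 / real k)"] by simp
    then have "1 / (c * real k) * \<bar>\<Sum>j<k. lip0_apply (P j f) x - lip0_apply f x\<bar>
        \<le> 1 / (c * real k) * norm f"
      using c1 k by (intro mult_left_mono) simp_all
    also have "\<dots> \<le> 1 / real k * norm f"
      using c1 k by (intro mult_right_mono) (simp_all add: field_simps)
    finally have u: "\<bar>1 / (c * real k) * (\<Sum>j<k. lip0_apply (P j f) x - lip0_apply f x)\<bar> \<le> 1 / real k * norm f"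
      using c1 by (simp add: abs_mult)
    have v: "\<bar>(1 - 1 / c) * lip0_apply f x\<bar> \<le> (1 - 1 / c) * (norm f * dist x basepoint)"
      using c1 lip0_apply_le_norm[of f x] by (simp add: abs_mult mult_left_mono)
    \<comment> \<open>The error splits into the sampling error, damped by \<open>1 / c\<close>, and
      the loss from normalisation.\<close>
    have eq: "lip0_apply (A f) x - lip0_apply f x
        = 1 / (c * real k) * (\<Sum>j<k. lip0_apply (P j f) x - lip0_apply f x) - (1 - 1 / c) * lip0_apply f x"
      using c1 k by (simp add: A sum_subtractf field_simps)
    have "\<bar>lip0_apply (A f) x - lip0_apply f x\<bar>
        \<le> 1 / real k * norm f + (1 - 1 / c) * (norm f * dist x basepoint)"
      unfolding eq by (rule order_trans[OF abs_triangle_ineq4 add_mono[OF u v]])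
    then show ?thesis
      by (simp add: algebra_simps)
  qed
  obtain T :: "'a free_space \<Rightarrow>\<^sub>L 'a free_space"
    where T: "\<And>u. free_space_functional (T u) = free_space_functional u o\<^sub>L A"
    and "finite_rank T" "norm T \<le> norm A"
    using free_space_predual[of "\<Union>j<k. range (r j)" A] fin A_span by blast
  moreover have "norm ((delta x o\<^sub>L A) - delta x) \<le> 1 / real k + (1 - 1 / c) * dist x basepoint" for x
    using c1 close[of _ x]
    by (intro norm_blinfun_bound) (simp_all add: blinfun.diff_left delta.rep_eq)
  ultimately show ?thesis
    using that[of T] \<open>norm A \<le> 1\<close>
    by (simp add: Abs_free_space_inverse[OF delta_in_free_space])
qed

section \<open>Retractions onto separated nets and selection of scales\<close>

text \<open>Replacing two points by net points within \<open>\<rho> * e\<close> adds at most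
  \<open>2 * \<rho> * e\<close> to their distance. Points closer than
  \<open>(1 - 2 * \<rho>) * e\<close> thus land at distance below \<open>e\<close>, where separation
  forces equality.\<close>

lemma separated_dense_retraction:
  fixes N :: "'a::metric_space set"
  assumes "separated_set e N" and "dense_within (\<rho> * e) N UNIV"
  obtains r where "range r \<subseteq> N" and "\<And>x. dist x (r x) \<le> \<rho> * e"
    and "\<And>x y. dist x y < (1 - 2 * \<rho>) * e \<Longrightarrow> r x = r y"
proof -
  have "\<forall>x. \<exists>y\<in>N. dist x y \<le> \<rho> * e"
    using assms(2) by (simp add: dense_within_def)
  then obtain r where r: "\<And>x. r x \<in> N" "\<And>x. dist x (r x) \<le> \<rho> * e"
    by metis
  have "r x = r y" if "dist x y < (1 - 2 * \<rho>) * e" for x y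
  proof -
    have "dist (r x) (r y) \<le> dist x (r x) + dist x y + dist y (r y)"
      using dist_triangle[of "r x" "r y" x] dist_triangle[of x "r y" y] by (simp add: dist_commute)
    also have "\<dots> < e"
      using r(2)[of x] r(2)[of y] that by (simp add: algebra_simps)
    finally show ?thesis
      using assms(1) r(1) by (force simp: separated_set_def)
  qed
  then show ?thesis
    using that r by blast
qed

text \<open>No monotonicity of \<open>\<epsilon>\<close> is assumed, so indices are picked one after
  another, each with a value below both \<open>a\<close> and \<open>q\<close> times the preceding
  value.\<close>

lemma rapidly_decreasing_scales:
  fixes \<epsilon> :: "nat \<Rightarrow> real"
  assumes pos: "\<And>n. \<epsilon> n > 0" and lim: "\<epsilon> \<longlonglongrightarrow> 0" and "0 < a" "0 < q" "q \<le> 1"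
  obtains g :: "nat \<Rightarrow> nat"
  where "\<And>j. \<epsilon> (g j) \<le> a" and "\<And>i j. i < j \<Longrightarrow> \<epsilon> (g j) \<le> q * \<epsilon> (g i)"
proof -
  have small: "\<exists>n. \<epsilon> n \<le> b" if "b > 0" for b
    using order_tendstoD(2)[OF lim that] by (auto simp: eventually_sequentially intro: less_imp_le)
  have "\<exists>g. \<forall>j. \<epsilon> (g j) \<le> a \<and> \<epsilon> (g (Suc j)) \<le> q * \<epsilon> (g j)"
  proof (rule dependent_nat_choice)
    show "\<exists>n. \<epsilon> n \<le> a"
      using small \<open>0 < a\<close> by blast
    show "\<exists>n. \<epsilon> n \<le> a \<and> \<epsilon> n \<le> q * \<epsilon> m" for m
      using small[of "min a (q * \<epsilon> m)"] \<open>0 < a\<close> \<open>0 < q\<close> pos[of m] by auto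
  qed
  then obtain g where g: "\<And>j. \<epsilon> (g j) \<le> a" "\<And>j. \<epsilon> (g (Suc j)) \<le> q * \<epsilon> (g j)"
    by blast
  have "\<epsilon> (g j) \<le> q * \<epsilon> (g i)" if "i < j" for i j
    using that
  proof (induction j rule: less_Suc_induct)
    case (2 i j k)
    \<comment> \<open>Chaining two steps produces a spare factor \<open>q\<close>, absorbed because
      \<open>q \<le> 1\<close>.\<close>
    have "q * \<epsilon> (g j) \<le> \<epsilon> (g j)"
      using mult_right_mono[OF \<open>q \<le> 1\<close>, of "\<epsilon> (g j)"] pos[of "g j"] by simp
    then show ?case
      using 2 by linarith
  qed (rule g(2))
  then show ?thesis
    using that g(1) by blast
qed

section \<open>Assembly of the approximating finite rank contractions\<close>

theorem proposition6:
  fixes \<epsilon> :: "nat \<Rightarrow> real" and \<rho> :: real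
    and N :: "nat \<Rightarrow> 'a::pointed_metric_space set"
  assumes "compact (UNIV :: 'a set)"
    and "\<And>n. \<epsilon> n > 0" and "\<epsilon> \<longlonglongrightarrow> 0"
    and "\<rho> < 1 / 2"
    and "\<And>n. finite (N n)"
    and "\<And>n. separated_set (\<epsilon> n) (N n)"
    and "\<And>n. dense_within (\<rho> * \<epsilon> n) (N n) UNIV"
  shows "metric_approximation_property TYPE('a free_space)"
proof -
  note pos = assms(2) and lim = assms(3)
  have "\<exists>r. range r \<subseteq> N n \<and> (\<forall>x. dist x (r x) \<le> \<rho> * \<epsilon> n) \<and>
      (\<forall>x y. dist x y < (1 - 2 * \<rho>) * \<epsilon> n \<longrightarrow> r x = r y)" for n
    by (metis separated_dense_retraction[OF assms(6,7)])
  then obtain r where range_r: "\<And>n. range (r n) \<subseteq> N n"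
    and near: "\<And>n x. dist x (r n x) \<le> \<rho> * \<epsilon> n"
    and const: "\<And>n x y. dist x y < (1 - 2 * \<rho>) * \<epsilon> n \<Longrightarrow> r n x = r n y"
    by metis
  \<comment> \<open>Density at the base point bounds a distance by
    \<open>\<rho> * \<epsilon> 0\<close>, so \<rho> cannot be negative. This gives
    \<open>s \<le> 1\<close>, hence a decay ratio of at most 1 below.\<close>
  have "0 \<le> \<rho> * \<epsilon> 0"
    using near[of basepoint 0] zero_le_dist order_trans by blast
  then have "0 \<le> \<rho>"
    using pos[of 0] by (simp add: zero_le_mult_iff)
  define s where "s = 1 - 2 * \<rho>"
  have s: "0 < s" "s \<le> 1"
    using \<open>\<rho> < 1 / 2\<close> \<open>0 \<le> \<rho>\<close> by (simp_all add: s_def)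
  have near': "dist x (r n x) \<le> \<epsilon> n / 2" for n x
    using near[of x n] mult_right_mono[of \<rho> "1 / 2" "\<epsilon> n"] \<open>\<rho> < 1 / 2\<close> pos[of n] by linarith
  have fin: "finite (range (r n))" for n
    using range_r assms(5) finite_subset by blast
  \<comment> \<open>The \<open>m\<close>-th operator averages \<open>Suc m\<close> scales, keeping
    the number of scales positive.\<close>
  define c where "c m = 1 + 1 / real (Suc m) + 1 / (s * real (Suc m))" for m
  have "\<exists>T :: 'a free_space \<Rightarrow>\<^sub>L 'a free_space. finite_rank T \<and> norm T \<le> 1 \<and>
      (\<forall>x. norm (free_space_functional (T (Abs_free_space (delta x))) - delta x)
        \<le> 1 / real (Suc m) + (1 - 1 / c m) * dist x basepoint)" for m
  proof -
    have q: "0 < s / real (Suc m)" "s / real (Suc m) \<le> 1"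
      using s by (simp_all add: field_simps)
    obtain g :: "nat \<Rightarrow> nat" where g: "\<And>j. \<epsilon> (g j) \<le> 1 / real (Suc m)"
      "\<And>i j. i < j \<Longrightarrow> \<epsilon> (g j) \<le> s / real (Suc m) * \<epsilon> (g i)"
      using rapidly_decreasing_scales[OF pos lim _ q, of "1 / real (Suc m)"] by auto
    show ?thesis
      by (rule averaged_samplings[of s "Suc m" "\<lambda>j. r (g j)" "\<lambda>j. \<epsilon> (g j)" "c m"])
        (use s g fin pos near' const in \<open>auto simp: c_def s_def\<close>)
  qed
  then obtain T :: "nat \<Rightarrow> 'a free_space \<Rightarrow>\<^sub>L 'a free_space"
    where T: "\<And>m. finite_rank (T m)" "\<And>m. norm (T m) \<le> 1"
    and bound: "\<And>m x. norm (free_space_functional (T m (Abs_free_space (delta x))) - delta x)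
        \<le> 1 / real (Suc m) + (1 - 1 / c m) * dist x basepoint"
    by metis
  have inv: "(\<lambda>m. 1 / real (Suc m)) \<longlonglongrightarrow> 0"
    using LIMSEQ_inverse_real_of_nat by (simp add: inverse_eq_divide)
  \<comment> \<open>As \<open>s\<close> is fixed, even the bad-scale term vanishes in the limit, so
    the normalising constants tend to 1 and the error at each \<open>delta x\<close> tends to
    0.\<close>
  have "(\<lambda>m. 1 + 1 / real (Suc m) + 1 / s * (1 / real (Suc m))) \<longlonglongrightarrow> 1 + 0 + 1 / s * 0"
    by (intro tendsto_intros inv)
  then have "c \<longlonglongrightarrow> 1"
    by (simp add: c_def[abs_def])
  have "(\<lambda>m. 1 / real (Suc m) + (1 - 1 / c m) * dist x basepoint)
      \<longlonglongrightarrow> 0 + (1 - 1 / 1) * dist x basepoint" for x :: 'a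
    by (intro tendsto_intros inv \<open>c \<longlonglongrightarrow> 1\<close>) simp
  then have bound_lim: "(\<lambda>m. 1 / real (Suc m) + (1 - 1 / c m) * dist x basepoint) \<longlonglongrightarrow> 0"
    for x :: 'a
    by simp
  have "(\<lambda>m. free_space_functional (T m (Abs_free_space (delta x)))) \<longlonglongrightarrow> delta x" for x
    by (rule Lim_null[THEN iffD2], rule Lim_null_comparison[OF _ bound_lim[of x]])
      (intro always_eventually allI bound)
  then have "(\<lambda>m. T m u) \<longlonglongrightarrow> u" for u
    by (rule free_space_tendstoI[OF T(2)])
  note T_lim = this
  have "id \<in> compact_convergence closure_of
      (blinfun_apply ` {T :: 'a free_space \<Rightarrow>\<^sub>L 'a free_space. finite_rank T \<and> norm T \<le> 1})"
    by (rule compact_convergence_closureI[of T]) (simp_all add: T T_lim)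
  moreover have "blinfun_apply ` {T. finite_rank T \<and> norm T \<le> 1}
      = {blinfun_apply T |T :: 'a free_space \<Rightarrow>\<^sub>L 'a free_space. finite_rank T \<and> norm T \<le> 1}"
    by (rule image_Collect)
  ultimately show ?thesis
    by (simp only: metric_approximation_property_def)
qed

end
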